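(* Let $N,M\ge 1$ be integers, let $V>0$, let $\mathbf{c}_1,\dots,\mathbf{c}_M\in\mathbb{R}^2$ and $\mathcal{R}_1,\dots,\mathcal{R}_M>0$. Let $\delta[1],\dots,\delta[N]>0$ and $\mathbf{q}[0],\mathbf{q}[1],\dots,\mathbf{q}[N]\in\mathbb{R}^2$ satisfy, for all $n\in\{1,\dots,N\}$, $$\|\mathbf{q}[n]-\mathbf{q}[n-1]\|\le V\delta[n],$$ and, for all $m\in\{1,\dots,M\}$ and $n\in\{1,\dots,N\}$, $$\|\mathbf{q}[n]-\mathbf{c}_m\|\ge\sqrt{\mathcal{R}_m^2+\left(\frac{V\delta[n]}{2}\right)^2},\qquad \|\mathbf{q}[n-1]-\mathbf{c}_m\|\ge\sqrt{\mathcal{R}_m^2+\left(\frac{V\delta[n]}{2}\right)^2}.$$ Then the UAV never violates any no-fly-zone along its entire continuous trajectory: for every $m\in\{1,\dots,M\}$, every $n\in\{1,\dots,N\}$ and every point $\mathbf{z}$ of the line segment $\overline{\mathbf{q}[n-1]\,\mathbf{q}[n]}$, one has $\|\mathbf{z}-\mathbf{c}_m\|\ge\mathcal{R}_m$.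
   Context: $\|\cdot\|$ is the Euclidean norm on $\mathbb{R}^2$, and $\overline{\mathbf{a}\,\mathbf{b}}$ is the closed line segment from $\mathbf{a}$ to $\mathbf{b}$. A UAV (unmanned aerial vehicle) flies at fixed altitude with maximum speed $V$; $\mathbf{q}[n]$ is its horizontal position at time slot $n$, and $\delta[n]$ is the length of time slot $n$. Between consecutive positions $\mathbf{q}[n-1]$ and $\mathbf{q}[n]$ it moves along the straight line segment joining them, so its continuous trajectory is the union of these segments. No-fly-zone $m$ is a cylinder whose horizontal cross-section is a disk with center $\mathbf{c}_m$ and radius $\mathcal{R}_m$; the UAV violates no-fly-zone $m$ at horizontal position $\mathbf{z}$ if $\|\mathbf{z}-\mathbf{c}_m\|<\mathcal{R}_m$. *)

theory Defs
  imports "HOL-Analysis.Analysis"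
begin

end

theory Submission
  imports Defs
begin

text \<open>
  Everything happens on one segment from \<open>a\<close> to \<open>b\<close> of length at most \<open>L = V * \<delta> n\<close>, with one
  centre \<open>p\<close>. Along the segment the squared distance to \<open>p\<close> is the linear interpolation of its
  endpoint values, lowered by \<open>u * (1 - u) * (norm (b - a))\<^sup>2\<close> (Stewart's theorem). Since
  \<open>u * (1 - u) \<le> 1 / 4\<close>, it drops by at most \<open>(L / 2)\<^sup>2\<close>, which is exactly the margin that the
  hypothesis adds to \<open>(R m)\<^sup>2\<close> at the endpoints.
\<close>

text \<open>
  Stewart's theorem, in vector form: with \<open>x = a - p\<close> and \<open>y = b - p\<close> both sides are the same
  quadratic form in \<open>x\<close> and \<open>y\<close>.
\<close>
lemma stewart_norm:
  fixes a b p :: "'a::real_inner"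
  shows "(norm ((1 - u) *\<^sub>R a + u *\<^sub>R b - p))\<^sup>2 =
    (1 - u) * (norm (a - p))\<^sup>2 + u * (norm (b - p))\<^sup>2 - u * (1 - u) * (norm (b - a))\<^sup>2"
proof -
  define x y where "x = a - p" and "y = b - p"
  have split: "(1 - u) *\<^sub>R a + u *\<^sub>R b - p = (1 - u) *\<^sub>R x + u *\<^sub>R y" "b - a = y - x"
    by (simp_all add: x_def y_def algebra_simps)
  show ?thesis
    unfolding split x_def [symmetric] y_def [symmetric] power2_norm_eq_inner
    by (simp add: inner_simps inner_commute [of y x] algebra_simps)
qed

lemma segment_avoids_ball:
  fixes a b p z :: "'a::real_inner"
  assumes z: "z \<in> closed_segment a b"
    and len: "norm (b - a) \<le> L"
    and a: "sqrt (r\<^sup>2 + (L / 2)\<^sup>2) \<le> norm (a - p)"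
    and b: "sqrt (r\<^sup>2 + (L / 2)\<^sup>2) \<le> norm (b - p)"
  shows "r \<le> norm (z - p)"
proof -
  obtain u where u: "0 \<le> u" "u \<le> 1" and z_eq: "z = (1 - u) *\<^sub>R a + u *\<^sub>R b"
    using z by (auto simp: in_segment)
  define K where "K = r\<^sup>2 + (L / 2)\<^sup>2"
  have "K \<le> (norm (a - p))\<^sup>2" "K \<le> (norm (b - p))\<^sup>2"
    using a [THEN sqrt_le_D] b [THEN sqrt_le_D] by (simp_all add: K_def)
  then have "(1 - u) * K + u * K \<le> (1 - u) * (norm (a - p))\<^sup>2 + u * (norm (b - p))\<^sup>2"
    using u by (intro add_mono mult_left_mono) auto
  moreover have "u * (1 - u) * (norm (b - a))\<^sup>2 \<le> (L / 2)\<^sup>2"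
  proof -
    have "u * (1 - u) \<le> 1 / 4"
      using zero_le_power2 [of "u - 1 / 2"] by (simp add: power2_eq_square algebra_simps)
    then have "u * (1 - u) * (norm (b - a))\<^sup>2 \<le> 1 / 4 * L\<^sup>2"
      using len by (intro mult_mono power_mono) auto
    then show ?thesis
      by (simp add: power_divide)
  qed
  ultimately have "r\<^sup>2 \<le> (norm (z - p))\<^sup>2"
    unfolding z_eq stewart_norm K_def by (simp add: algebra_simps)
  then show ?thesis
    by (rule power2_le_imp_le) simp
qed

theorem mainTheorem2:
  fixes N M :: nat
    and V :: real
    and c :: "nat \<Rightarrow> real ^ 2"
    and R :: "nat \<Rightarrow> real"
    and \<delta> :: "nat \<Rightarrow> real"
    and q :: "nat \<Rightarrow> real ^ 2"
  assumes "N \<ge> 1" and "M \<ge> 1" and "V > 0"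
    and "\<forall>m\<in>{1..M}. R m > 0"
    and "\<forall>n\<in>{1..N}. \<delta> n > 0"
    and "\<forall>n\<in>{1..N}. norm (q n - q (n - 1)) \<le> V * \<delta> n"
    and "\<forall>m\<in>{1..M}. \<forall>n\<in>{1..N}.
           norm (q n - c m) \<ge> sqrt ((R m)\<^sup>2 + (V * \<delta> n / 2)\<^sup>2)"
    and "\<forall>m\<in>{1..M}. \<forall>n\<in>{1..N}.
           norm (q (n - 1) - c m) \<ge> sqrt ((R m)\<^sup>2 + (V * \<delta> n / 2)\<^sup>2)"
  shows "\<forall>m\<in>{1..M}. \<forall>n\<in>{1..N}. \<forall>z\<in>closed_segment (q (n - 1)) (q n).
           norm (z - c m) \<ge> R m"
proof (intro ballI)
  fix m n z
  assume m: "m \<in> {1..M}" and n: "n \<in> {1..N}"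
    and z: "z \<in> closed_segment (q (n - 1)) (q n)"
  from z show "R m \<le> norm (z - c m)"
  proof (rule segment_avoids_ball)
    show "norm (q n - q (n - 1)) \<le> V * \<delta> n"
      using assms(6) n by blast
    show "sqrt ((R m)\<^sup>2 + (V * \<delta> n / 2)\<^sup>2) \<le> norm (q (n - 1) - c m)"
      using assms(8) m n by blast
    show "sqrt ((R m)\<^sup>2 + (V * \<delta> n / 2)\<^sup>2) \<le> norm (q n - c m)"
      using assms(7) m n by blast
  qed
qed

end
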